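(* For every complex number $a$ with $3a\notin\{0,-1,-2,\dots\}$, $$F_1\left(2a;\,1-3a,\,5a-\tfrac32;\,3a;\,-\tfrac3{125},\tfrac9{25}\right)=\frac{2^{2a}5^{a}}{3^{3a}}\,\frac{\sqrt\pi\,\Gamma(3a)}{\Gamma(a+1/2)\,\Gamma(2a)}.$$
   Context: Appell's hypergeometric series is $F_1(\alpha;\beta_1,\beta_2;\gamma;x,y)=\sum_{m,n\ge0}\frac{(\alpha,m+n)(\beta_1,m)(\beta_2,n)}{(\gamma,m+n)(1,m)(1,n)}x^my^n$ for $\gamma\notin\{0,-1,-2,\dots\}$, absolutely convergent for $|x|<1$, $|y|<1$, where $(\alpha,n)=\alpha(\alpha+1)\cdots(\alpha+n-1)$, $(\alpha,0)=1$. For real $r>0$, $r^{a}=e^{a\log r}$ with real $\log r$. $1/\Gamma$ is the entire function (zero at the poles of $\Gamma$). *)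

theory Defs
  imports "HOL-Analysis.Analysis"
begin

text \<open>Unordered summation over all pairs \<open>(m, n)\<close>: for complex-valued series, summability in this
  sense is absolute convergence. Meaningful for \<open>c \<notin> \<int>\<^sub>\<le>\<^sub>0\<close> and \<open>norm x < 1\<close>, \<open>norm y < 1\<close>.\<close>

definition appell_F1 ::
    "complex \<Rightarrow> complex \<Rightarrow> complex \<Rightarrow> complex \<Rightarrow> complex \<Rightarrow> complex \<Rightarrow> complex" where
  "appell_F1 a b1 b2 c x y =
     (\<Sum>\<^sub>\<infinity>(m, n) \<in> UNIV.
        pochhammer a (m + n) * pochhammer b1 m * pochhammer b2 n /
        (pochhammer c (m + n) * pochhammer 1 m * pochhammer 1 n) * x ^ m * y ^ n)"

end

theory Submission
  imports Defs "HOL-Complex_Analysis.Complex_Analysis"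
begin

text \<open>
  By Euler's integral, for real \<open>a > 1\<close> the series is \<open>1 / B(2a, a)\<close> times the integral over \<open>[0, 1]\<close> of
  \<open>\<phi>\<^sup>a \<omega>\<close>, where \<open>\<phi> = u\<^sup>2 (1 - u) (1 + 3u/125)\<^sup>3 / (1 - 9u/25)\<^sup>5\<close> and
  \<open>\<omega> = (1 - 9u/25)\<^bsup>3/2\<^esup> / (u (1 - u) (1 + 3u/125)) du\<close>. The rational function \<open>t = 27/20 \<phi>\<close> is a Belyi map of degree 6
  all of whose preimages of 1 are double, so \<open>1 - t = s\<^sup>2\<close> with \<open>s = N(u) (1 - 9u/25)\<^bsup>-5/2\<^esup>\<close> for a cubic
  polynomial \<open>N\<close>, and \<open>s\<close> runs from \<open>1\<close> to \<open>-1\<close>. Moreover \<open>-ds = t \<omega>\<close>, so the integral is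
  \<open>(20/27)\<^sup>a\<close> times the integral of \<open>(1 - s\<^sup>2)\<^bsup>a-1\<^esup>\<close> over \<open>[-1, 1]\<close>, which is \<open>2\<^bsup>2a-1\<^esup> B(a, a)\<close>;
  Legendre's duplication formula gives the claimed value. Divided by \<open>\<Gamma>(3a)\<close>, both sides are entire in \<open>a\<close>,
  so the identity extends to all \<open>a\<close>.
\<close>

section \<open>Binomial series and products of absolutely convergent series\<close>

lemma norm_pochhammer_le:
  fixes z :: "'a :: real_normed_field"
  assumes "norm z \<le> B"
  shows "norm (pochhammer z n) \<le> pochhammer B n"
proof (induction n)
  case (Suc n)
  have "norm (z + of_nat n) \<le> B + real n"
    using norm_triangle_ineq[of z "of_nat n"] assms by simp
  with Suc show ?case
    by (auto simp: pochhammer_Suc norm_mult intro!: mult_mono intro: order_trans[OF norm_ge_zero])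
qed simp

text \<open>Newton's binomial series: the signs of \<open>(-b) gchoose n\<close> and
  \<open>(-z) ^ n\<close> cancel.\<close>

lemma pochhammer_series_sums:
  fixes b z :: real
  assumes "\<bar>z\<bar> < 1"
  shows "(\<lambda>n. pochhammer b n / fact n * z ^ n) sums (1 - z) powr (-b)"
proof -
  have "(\<lambda>n. ((-b) gchoose n) * (-z) ^ n) sums (1 + (-z)) powr (-b)"
    using assms by (intro gen_binomial_real) auto
  also have "(\<lambda>n. ((-b) gchoose n) * (-z) ^ n) = (\<lambda>n. pochhammer b n / fact n * z ^ n)"
    by (auto simp: gbinomial_pochhammer power_minus[of z] fun_eq_iff)
  finally show ?thesis by simp
qed

text \<open>The real binomial series with parameters \<open>norm b\<close> and \<open>norm z\<close>
  is a convergent majorant.\<close>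

lemma pochhammer_series_summable_norm:
  fixes b z :: "'a :: {real_normed_field, banach}"
  assumes "norm z < 1"
  shows "(\<lambda>n. norm (pochhammer b n / fact n * z ^ n)) summable_on UNIV"
proof -
  have "summable (\<lambda>n. pochhammer (norm b) n / fact n * norm z ^ n)"
    using pochhammer_series_sums[of "norm z" "norm b"] assms by (auto simp: sums_iff)
  then have "summable (\<lambda>n. norm (pochhammer b n / fact n * z ^ n))"
    by (rule summable_comparison_test')
       (auto simp: norm_mult norm_divide norm_power intro!: mult_right_mono divide_right_mono norm_pochhammer_le)
  then show ?thesis
    by (simp add: summable_on_UNIV_nonneg_real_iff)
qed

lemma pochhammer_series_has_sum:
  fixes b z :: real
  assumes "\<bar>z\<bar> < 1"
  shows "((\<lambda>n. pochhammer b n / fact n * z ^ n) has_sum (1 - z) powr (-b)) UNIV"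
  using pochhammer_series_sums[OF assms, of b] pochhammer_series_summable_norm[of z b] assms
  by (intro norm_summable_imp_has_sum) (auto simp: summable_on_UNIV_nonneg_real_iff)

lemma summable_norm_Times_mult:
  fixes f :: "'a \<Rightarrow> 'c :: {real_normed_field, banach}" and g :: "'b \<Rightarrow> 'c"
  assumes "(\<lambda>x. norm (f x)) summable_on A" "(\<lambda>y. norm (g y)) summable_on B"
  shows "(\<lambda>p. norm (case p of (x, y) \<Rightarrow> f x * g y)) summable_on A \<times> B"
proof -
  have "(\<lambda>(x, y). norm (f x) * norm (g y)) summable_on A \<times> B"
  proof (rule summable_on_SigmaI)
    show "((\<lambda>y. case (x, y) of (x, y) \<Rightarrow> norm (f x) * norm (g y)) has_sum
            norm (f x) * (\<Sum>\<^sub>\<infinity>y\<in>B. norm (g y))) B" for x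
      using assms by (auto intro!: has_sum_cmult_right)
    show "(\<lambda>x. norm (f x) * (\<Sum>\<^sub>\<infinity>y\<in>B. norm (g y))) summable_on A"
      using assms by (intro summable_on_cmult_left)
  qed auto
  then show ?thesis
    by (simp add: norm_mult case_prod_unfold)
qed

lemma has_sum_Times_mult:
  fixes f :: "'a \<Rightarrow> 'c :: {real_normed_field, banach}" and g :: "'b \<Rightarrow> 'c"
  assumes "(\<lambda>x. norm (f x)) summable_on A" "(\<lambda>y. norm (g y)) summable_on B" "(f has_sum S) A" "(g has_sum T) B"
  shows "((\<lambda>(x, y). f x * g y) has_sum S * T) (A \<times> B)"
proof (rule has_sum_SigmaI)
  show "((\<lambda>y. case (x, y) of (x, y) \<Rightarrow> f x * g y) has_sum f x * T) B" for x
    using assms by (auto intro!: has_sum_cmult_right)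
  show "((\<lambda>x. f x * T) has_sum S * T) A"
    using assms by (auto intro!: has_sum_cmult_left)
  show "(\<lambda>(x, y). f x * g y) summable_on A \<times> B"
    using summable_norm_Times_mult[OF assms(1,2)] by (rule abs_summable_summable)
qed

section \<open>Euler's integral for the Appell series\<close>

text \<open>With \<open>\<beta> = \<gamma> - \<alpha>\<close>, normalised Beta moments are exactly
  the factors of the Appell coefficients that depend on \<open>m + n\<close>.\<close>

lemma Beta_plus_of_nat:
  fixes \<alpha> \<beta> :: real
  assumes "\<alpha> > 0" "\<beta> > 0"
  shows "Beta (\<alpha> + real k) \<beta> = Beta \<alpha> \<beta> * (pochhammer \<alpha> k / pochhammer (\<alpha> + \<beta>) k)"
proof -
  have *: "\<alpha> \<notin> \<int>\<^sub>\<le>\<^sub>0" "\<alpha> + \<beta> \<notin> \<int>\<^sub>\<le>\<^sub>0"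
    using assms nonpos_Ints_nonpos by fastforce+
  have pos: "Gamma \<alpha> > 0" "Gamma (\<alpha> + \<beta>) > 0" "Gamma (\<alpha> + real k) > 0" "Gamma (\<alpha> + \<beta> + real k) > 0"
    using assms by (auto intro!: Gamma_real_pos)
  show ?thesis
    using pos by (simp add: Beta_def pochhammer_Gamma * add_ac divide_simps)
qed

text \<open>Expand both binomials and integrate term by term. Exponents \<open>\<alpha> - 1\<close>
  and \<open>\<gamma> - \<alpha> - 1\<close> that are positive keep the kernel continuous and
  bounded by 1 on the closed interval, so uniform convergence justifies the exchange.\<close>

lemma appell_F1_Euler_integral:
  fixes \<alpha> \<beta>\<^sub>1 \<beta>\<^sub>2 \<gamma> x y I :: real
  assumes "\<alpha> > 1" "\<gamma> - \<alpha> > 1" "\<bar>x\<bar> < 1" "\<bar>y\<bar> < 1"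
    and I: "((\<lambda>u. u powr (\<alpha> - 1) * (1 - u) powr (\<gamma> - \<alpha> - 1) *
              ((1 - x * u) powr (-\<beta>\<^sub>1) * (1 - y * u) powr (-\<beta>\<^sub>2))) has_integral I) {0..1}"
  shows "appell_F1 (of_real \<alpha>) (of_real \<beta>\<^sub>1) (of_real \<beta>\<^sub>2) (of_real \<gamma>) (of_real x) (of_real y) =
           of_real (I / Beta \<alpha> (\<gamma> - \<alpha>))"
proof -
  define c1 where "c1 m = pochhammer \<beta>\<^sub>1 m / fact m * x ^ m" for m
  define c2 where "c2 n = pochhammer \<beta>\<^sub>2 n / fact n * y ^ n" for n
  define k where "k u = u powr (\<alpha> - 1) * (1 - u) powr (\<gamma> - \<alpha> - 1)" for u
  define f where "f = (\<lambda>(m, n) u. c1 m * c2 n * (u ^ (m + n) * k u))"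
  define g where "g u = k u * ((1 - x * u) powr (-\<beta>\<^sub>1) * (1 - y * u) powr (-\<beta>\<^sub>2))" for u
  have k01: "0 \<le> k u \<and> k u \<le> 1" if "u \<in> {0..1}" for u
    using that assms by (auto simp: k_def intro!: mult_le_one powr_le1)
  have abs12: "(\<lambda>m. norm (c1 m)) summable_on UNIV" "(\<lambda>n. norm (c2 n)) summable_on UNIV"
    unfolding c1_def c2_def using assms by (intro pochhammer_series_summable_norm; simp)+
  have f_integral: "(f p has_integral c1 (fst p) * c2 (snd p) * Beta (\<alpha> + real (fst p + snd p)) (\<gamma> - \<alpha>)) {0..1}" for p
  proof -
    have "((\<lambda>u. u powr (\<alpha> + real (fst p + snd p) - 1) * (1 - u) powr (\<gamma> - \<alpha> - 1)) has_integral
            Beta (\<alpha> + real (fst p + snd p)) (\<gamma> - \<alpha>)) {0..1}"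
      using assms by (intro has_integral_Beta_real) auto
    then have "((\<lambda>u. u ^ (fst p + snd p) * k u) has_integral
            Beta (\<alpha> + real (fst p + snd p)) (\<gamma> - \<alpha>)) {0..1}"
    proof (rule has_integral_eq[rotated])
      fix u :: real assume u: "u \<in> {0..1}"
      show "u powr (\<alpha> + real (fst p + snd p) - 1) * (1 - u) powr (\<gamma> - \<alpha> - 1) = u ^ (fst p + snd p) * k u"
      \<comment> \<open>At \<open>u = 0\<close> both sides vanish, because \<open>0 powr r\<close>
        is 0 for every \<open>r\<close>.\<close>
      proof (cases "u = 0")
        case False
        with u have "u powr (\<alpha> + real (fst p + snd p) - 1) = u ^ (fst p + snd p) * u powr (\<alpha> - 1)"
          by (subst powr_realpow [symmetric], simp, subst powr_add [symmetric]) (simp add: algebra_simps)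
        then show ?thesis by (simp add: k_def)
      qed (simp add: k_def)
    qed
    then show ?thesis
      unfolding f_def case_prod_unfold by (intro has_integral_mult_right)
  qed
  have f_cont: "continuous_on {0..1} (f p)" for p
    unfolding f_def case_prod_unfold k_def using assms
    by (intro continuous_intros continuous_on_powr') auto
  have f_le: "norm (f p u) \<le> norm (case p of (m, n) \<Rightarrow> c1 m * c2 n)" if "u \<in> {0..1}" for p u
  proof -
    have "norm (f p u) = norm (case p of (m, n) \<Rightarrow> c1 m * c2 n) * (u ^ (fst p + snd p) * k u)"
      using that k01[OF that] by (simp add: f_def case_prod_unfold abs_mult)
    also have "u ^ (fst p + snd p) * k u \<le> 1"
      using that k01[OF that] by (intro mult_le_one power_le_one) auto
    finally show ?thesis
      by (simp add: mult_left_mono)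
  qed
  have f_sum: "((\<lambda>p. f p u) has_sum g u) UNIV" if u: "u \<in> {0..1}" for u
  proof -
    have *: "\<bar>z * u\<bar> < 1" if "\<bar>z\<bar> < 1" for z :: real
      using that u mult_left_le[of "\<bar>u\<bar>" "\<bar>z\<bar>"] by (auto simp: abs_mult)
    have "((\<lambda>(m, n). (pochhammer \<beta>\<^sub>1 m / fact m * (x * u) ^ m) * (pochhammer \<beta>\<^sub>2 n / fact n * (y * u) ^ n)) has_sum
        (1 - x * u) powr (-\<beta>\<^sub>1) * (1 - y * u) powr (-\<beta>\<^sub>2)) (UNIV \<times> UNIV)"
      using assms *
      by (intro has_sum_Times_mult pochhammer_series_has_sum pochhammer_series_summable_norm)
         (simp_all only: real_norm_def)
    from has_sum_cmult_right[OF this, of "k u"] show ?thesis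
      by (simp add: f_def g_def c1_def c2_def case_prod_unfold power_mult_distrib power_add mult_ac)
  qed
  \<comment> \<open>The M-test is applied along the filter of finite sets of index pairs, so the
    limit of the integrals is directly an unordered sum.\<close>
  have "uniform_limit {0..1} (\<lambda>X u. \<Sum>p\<in>X. f p u) g (finite_subsets_at_top UNIV)"
    using f_le f_sum summable_norm_Times_mult[OF abs12]
    by (intro Weierstrass_m_test_general'[where M = "\<lambda>p. norm (case p of (m, n) \<Rightarrow> c1 m * c2 n)"]) auto
  then obtain IX J where IX: "\<And>X. ((\<lambda>u. \<Sum>p\<in>X. f p u) has_integral IX X) {0..1}"
    and J: "(g has_integral J) {0..1}" and lim: "(IX \<longlongrightarrow> J) (finite_subsets_at_top UNIV)"
    by (rule uniform_limit_integral) (use f_cont in \<open>auto intro!: continuous_on_sum\<close>)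
  have "J = I"
    using J I unfolding g_def k_def by (rule has_integral_unique)
  have IX_eq: "IX X = (\<Sum>p\<in>X. c1 (fst p) * c2 (snd p) * Beta (\<alpha> + real (fst p + snd p)) (\<gamma> - \<alpha>))"
    if "finite X" for X
    using IX[of X] has_integral_sum[OF that f_integral] by (rule has_integral_unique)
  have Beta_pos: "Beta \<alpha> (\<gamma> - \<alpha>) > 0"
    using assms by (auto simp: Beta_def intro!: divide_pos_pos mult_pos_pos Gamma_real_pos)
  have "((\<lambda>X. \<Sum>p\<in>X. c1 (fst p) * c2 (snd p) * Beta (\<alpha> + real (fst p + snd p)) (\<gamma> - \<alpha>)) \<longlongrightarrow> I)
          (finite_subsets_at_top UNIV)"
    using lim unfolding \<open>J = I\<close>
    \<comment> \<open>\<open>IX X\<close> is identified only for finite \<open>X\<close>, which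
      holds eventually along this filter.\<close>
    by (rule Lim_transform_eventually)
       (auto intro!: eventually_finite_subsets_at_top_weakI simp: IX_eq)
  then have "((\<lambda>p. c1 (fst p) * c2 (snd p) * Beta (\<alpha> + real (fst p + snd p)) (\<gamma> - \<alpha>)) has_sum I) UNIV"
    by (simp add: has_sum_def)
  then have "((\<lambda>p. c1 (fst p) * c2 (snd p) * Beta (\<alpha> + real (fst p + snd p)) (\<gamma> - \<alpha>) * inverse (Beta \<alpha> (\<gamma> - \<alpha>)))
      has_sum (I * inverse (Beta \<alpha> (\<gamma> - \<alpha>)))) UNIV"
    by (rule has_sum_cmult_left)
  also have "(\<lambda>p. c1 (fst p) * c2 (snd p) * Beta (\<alpha> + real (fst p + snd p)) (\<gamma> - \<alpha>) * inverse (Beta \<alpha> (\<gamma> - \<alpha>))) =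
      (\<lambda>(m, n). pochhammer \<alpha> (m + n) * pochhammer \<beta>\<^sub>1 m * pochhammer \<beta>\<^sub>2 n /
        (pochhammer \<gamma> (m + n) * pochhammer 1 m * pochhammer 1 n) * x ^ m * y ^ n)"
  proof (rule ext)
    fix p :: "nat \<times> nat"
    obtain m n where p: "p = (m, n)" by fastforce
    show "c1 (fst p) * c2 (snd p) * Beta (\<alpha> + real (fst p + snd p)) (\<gamma> - \<alpha>) * inverse (Beta \<alpha> (\<gamma> - \<alpha>)) =
      (case p of (m, n) \<Rightarrow> pochhammer \<alpha> (m + n) * pochhammer \<beta>\<^sub>1 m * pochhammer \<beta>\<^sub>2 n /
        (pochhammer \<gamma> (m + n) * pochhammer 1 m * pochhammer 1 n) * x ^ m * y ^ n)"
    proof -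
      have "Beta (\<alpha> + real (m + n)) (\<gamma> - \<alpha>) * inverse (Beta \<alpha> (\<gamma> - \<alpha>)) = pochhammer \<alpha> (m + n) / pochhammer \<gamma> (m + n)"
        using Beta_pos Beta_plus_of_nat[of \<alpha> "\<gamma> - \<alpha>" "m + n"] assms by simp
      then show ?thesis
        by (simp add: p c1_def c2_def mult.assoc del: of_nat_add flip: pochhammer_fact)
    qed
  qed
  finally have "((\<lambda>p. complex_of_real (case p of (m, n) \<Rightarrow> pochhammer \<alpha> (m + n) * pochhammer \<beta>\<^sub>1 m * pochhammer \<beta>\<^sub>2 n /
        (pochhammer \<gamma> (m + n) * pochhammer 1 m * pochhammer 1 n) * x ^ m * y ^ n)) has_sum of_real (I / Beta \<alpha> (\<gamma> - \<alpha>))) UNIV"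
    unfolding divide_inverse[of I] by (rule has_sum_of_real)
  then show ?thesis
    unfolding appell_F1_def
    by (intro infsumI) (simp add: case_prod_unfold pochhammer_of_real flip: pochhammer_fact)
qed

section \<open>Holomorphic dependence of the regularised series on its parameters\<close>

text \<open>Consecutive terms have ratio \<open>(\<alpha> + k) / (\<gamma> + k)\<close>, of norm at most \<open>\<rho>\<close> for large \<open>k\<close>
  uniformly on \<open>K\<close>; the finitely many remaining terms are bounded by compactness.\<close>

lemma pochhammer_rGamma_bound:
  assumes K: "compact K" and cont: "continuous_on K \<alpha>" "continuous_on K \<gamma>" and "\<rho> > 1"
  shows "\<exists>C. \<forall>a\<in>K. \<forall>k. norm (pochhammer (\<alpha> a) k * rGamma (\<gamma> a + of_nat k) :: complex) \<le> C * \<rho> ^ k"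
proof -
  define h where "h k a = pochhammer (\<alpha> a) k * rGamma (\<gamma> a + of_nat k)" for k a
  have "bounded (\<alpha> ` K)" "bounded (\<gamma> ` K)"
    using K cont by (auto intro!: compact_imp_bounded compact_continuous_image)
  then obtain A B where A: "norm (\<alpha> a) \<le> A" and B: "norm (\<gamma> a) \<le> B" if "a \<in> K" for a
    by (auto simp: bounded_iff)
  \<comment> \<open>The first bound is \<open>A + k \<le> \<rho> * (k - B)\<close> solved for
    \<open>k\<close>, with strict inequality.\<close>
  obtain k0 :: nat where k0: "real k0 > (A + \<rho> * B) / (\<rho> - 1)" "real k0 > B"
    by (metis (no_types) reals_Archimedean2 max_less_iff_conj)
  have h_Suc: "norm (h (Suc k) a) \<le> \<rho> * norm (h k a)" if "a \<in> K" "k \<ge> k0" for k a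
  proof -
    have k: "A + real k \<le> \<rho> * (real k - B)" "real k > B"
      using k0 \<open>k \<ge> k0\<close> \<open>\<rho> > 1\<close> mult_nonneg_nonneg[of "\<rho> - 1" "real k - real k0"]
      by (simp_all add: field_simps)
    have le: "real k - B \<le> norm (\<gamma> a + of_nat k)"
      using norm_diff_ineq[of "of_nat k" "\<gamma> a"] B[OF \<open>a \<in> K\<close>] by (simp add: add.commute)
    have "norm (\<alpha> a + of_nat k) \<le> A + real k"
      using norm_triangle_ineq[of "\<alpha> a" "of_nat k"] A[OF \<open>a \<in> K\<close>] by simp
    also have "\<dots> \<le> \<rho> * (real k - B)" by (rule k)
    also have "\<dots> \<le> \<rho> * norm (\<gamma> a + of_nat k)"
      using le \<open>\<rho> > 1\<close> by (intro mult_left_mono) auto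
    finally have *: "norm (\<alpha> a + of_nat k) \<le> \<rho> * norm (\<gamma> a + of_nat k)" .
    \<comment> \<open>Using the recurrence \<open>z * rGamma (z + 1) = rGamma z\<close> instead of a
      quotient keeps the step valid where \<open>rGamma\<close> vanishes.\<close>
    have "h k a = pochhammer (\<alpha> a) k * (\<gamma> a + of_nat k) * rGamma (\<gamma> a + of_nat (Suc k))"
      using rGamma_plus1[of "\<gamma> a + of_nat k"] by (simp add: h_def add_ac)
    then have "\<rho> * norm (h k a) = norm (pochhammer (\<alpha> a) k) * (\<rho> * norm (\<gamma> a + of_nat k)) * norm (rGamma (\<gamma> a + of_nat (Suc k)))"
      by (simp add: norm_mult)
    also have "\<dots> \<ge> norm (pochhammer (\<alpha> a) k) * norm (\<alpha> a + of_nat k) * norm (rGamma (\<gamma> a + of_nat (Suc k)))"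
      using * by (intro mult_left_mono mult_right_mono) auto
    finally show ?thesis
      by (simp only: h_def norm_mult pochhammer_Suc)
  qed
  have "\<exists>C. \<forall>a\<in>K. norm (h k a) \<le> C" for k
  proof -
    have "continuous_on K (h k)"
      unfolding h_def pochhammer_prod using cont
      by (intro continuous_intros continuous_on_compose2[OF continuous_on_rGamma[of UNIV]]) auto
    then have "bounded (h k ` K)"
      using K by (intro compact_imp_bounded compact_continuous_image)
    then show ?thesis
      by (auto simp: bounded_iff)
  qed
  then obtain C where C: "\<And>k a. a \<in> K \<Longrightarrow> norm (h k a) \<le> C k"
    by metis
  define D where "D = (\<Sum>k\<le>k0. \<bar>C k\<bar>)"
  have small: "norm (h k a) \<le> D" if "a \<in> K" "k \<le> k0" for k a
  proof -
    have "norm (h k a) \<le> \<bar>C k\<bar>" using C[OF that(1), of k] by simp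
    also have "\<dots> \<le> D" unfolding D_def using that by (intro member_le_sum) auto
    finally show ?thesis .
  qed
  have "D \<ge> 0" unfolding D_def by (intro sum_nonneg) auto
  have "norm (h k a) \<le> D * \<rho> ^ k" if a: "a \<in> K" for k a
  proof (induction k)
    case 0
    show ?case using small[OF a, of 0] by simp
  next
    case (Suc k)
    show ?case
    proof (cases "k \<ge> k0")
      case True
      have "norm (h (Suc k) a) \<le> \<rho> * norm (h k a)" by (rule h_Suc[OF a True])
      also have "\<dots> \<le> \<rho> * (D * \<rho> ^ k)"
        using Suc \<open>\<rho> > 1\<close> by (intro mult_left_mono) auto
      finally show ?thesis by (simp add: mult_ac)
    next
      case False
      then have "norm (h (Suc k) a) \<le> D * 1" using small[OF a, of "Suc k"] by simp
      also have "\<dots> \<le> D * \<rho> ^ Suc k"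
        using \<open>D \<ge> 0\<close> \<open>\<rho> > 1\<close> by (intro mult_left_mono one_le_power) auto
      finally show ?thesis .
    qed
  qed
  then show ?thesis unfolding h_def by blast
qed

lemma holomorphic_on_pochhammer [holomorphic_intros]:
  "f holomorphic_on S \<Longrightarrow> (\<lambda>z. pochhammer (f z) n) holomorphic_on S"
  unfolding pochhammer_prod by (intro holomorphic_intros)

text \<open>Provides the room to absorb the geometric growth \<open>\<rho> ^ k\<close> of the
  coefficients into the powers of \<open>x\<close> and \<open>y\<close>.\<close>

lemma scale_less_one:
  assumes "(r :: real) < 1"
  shows "\<exists>\<rho>>1. \<rho> * r < 1"
proof (cases "r \<le> 0")
  case True
  have "2 * r < 1" using True by linarith
  then show ?thesis by (intro exI[of _ 2]) auto
next
  case False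
  then obtain \<rho> where "1 < \<rho>" "\<rho> < 1 / r"
    using assms dense[of 1 "1 / r"] by auto
  with False show ?thesis by (intro exI[of _ \<rho>]) (auto simp: field_simps)
qed

text \<open>This is the Appell series divided by \<open>Gamma \<gamma>\<close>. Moving that factor
  into each term turns \<open>1 / pochhammer \<gamma> k\<close> into
  \<open>rGamma (\<gamma> + k)\<close>, which is entire, so the poles at nonpositive integers
  \<open>\<gamma>\<close> disappear.\<close>

definition appell_F1_reg ::
    "complex \<Rightarrow> complex \<Rightarrow> complex \<Rightarrow> complex \<Rightarrow> complex \<Rightarrow> complex \<Rightarrow> complex" where
  "appell_F1_reg \<alpha> \<beta>\<^sub>1 \<beta>\<^sub>2 \<gamma> x y =
     (\<Sum>\<^sub>\<infinity>(m, n)\<in>UNIV. (pochhammer \<alpha> (m + n) * rGamma (\<gamma> + of_nat (m + n))) *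
        ((pochhammer \<beta>\<^sub>1 m / fact m * x ^ m) * (pochhammer \<beta>\<^sub>2 n / fact n * y ^ n)))"

lemma appell_F1_reg_eq:
  assumes "\<gamma> \<notin> \<int>\<^sub>\<le>\<^sub>0"
  shows "appell_F1_reg \<alpha> \<beta>\<^sub>1 \<beta>\<^sub>2 \<gamma> x y = rGamma \<gamma> * appell_F1 \<alpha> \<beta>\<^sub>1 \<beta>\<^sub>2 \<gamma> x y"
proof -
  have "rGamma (\<gamma> + of_nat k) = rGamma \<gamma> / pochhammer \<gamma> k" for k
  proof -
    have "pochhammer \<gamma> k \<noteq> 0"
      using assms by (auto simp: pochhammer_eq_0_iff)
    then show ?thesis using pochhammer_rGamma[of \<gamma> k] by (simp add: field_simps)
  qed
  then show ?thesis
    unfolding appell_F1_reg_def appell_F1_def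
    by (simp add: infsum_cmult_right' [symmetric] case_prod_unfold pochhammer_fact [symmetric] mult_ac del: of_nat_add)
qed

text \<open>On each closed ball inside \<open>S\<close> the terms have a summable majorant: the
  factor in \<open>m + n\<close> grows at most like \<open>\<rho> ^ (m + n)\<close>, and the rest is
  dominated by two binomial series whose arguments, scaled by \<open>\<rho>\<close>, stay below 1.
  Weierstrass' theorem then applies.\<close>

lemma holomorphic_on_appell_F1_reg:
  assumes "open S" "norm x < 1" "norm y < 1"
    and hol: "\<alpha> holomorphic_on S" "\<beta>\<^sub>1 holomorphic_on S" "\<beta>\<^sub>2 holomorphic_on S" "\<gamma> holomorphic_on S"
  shows "(\<lambda>a. appell_F1_reg (\<alpha> a) (\<beta>\<^sub>1 a) (\<beta>\<^sub>2 a) (\<gamma> a) x y) holomorphic_on S"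
proof -
  define f where "f = (\<lambda>(m, n) a. (pochhammer (\<alpha> a) (m + n) * rGamma (\<gamma> a + of_nat (m + n))) *
        ((pochhammer (\<beta>\<^sub>1 a) m / fact m * x ^ m) * (pochhammer (\<beta>\<^sub>2 a) n / fact n * y ^ n)))"
  obtain \<rho> where \<rho>: "\<rho> > 1" "\<rho> * max (norm x) (norm y) < 1"
    using scale_less_one[of "max (norm x) (norm y)"] assms by auto
  have \<rho>_less: "\<rho> * norm x < 1" "\<rho> * norm y < 1"
    using \<rho> by (auto intro!: order_le_less_trans[OF mult_left_mono \<rho>(2)])
  have f_hol: "f p holomorphic_on S" for p
    unfolding f_def case_prod_unfold using hol by (intro holomorphic_intros) auto
  have "(\<lambda>a. \<Sum>\<^sub>\<infinity>p. f p a) holomorphic_on ball z r" if r: "cball z r \<subseteq> S" for z r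
  proof -
    let ?K = "cball z r"
    have cont: "continuous_on ?K \<alpha>" "continuous_on ?K \<beta>\<^sub>1" "continuous_on ?K \<beta>\<^sub>2" "continuous_on ?K \<gamma>"
      using hol r by (auto intro: holomorphic_on_imp_continuous_on holomorphic_on_subset)
    obtain C where C: "\<And>a k. a \<in> ?K \<Longrightarrow> norm (pochhammer (\<alpha> a) k * rGamma (\<gamma> a + of_nat k)) \<le> C * \<rho> ^ k"
      using pochhammer_rGamma_bound[OF compact_cball cont(1,4) \<rho>(1)] by blast
    have "bounded (\<beta>\<^sub>1 ` ?K)" "bounded (\<beta>\<^sub>2 ` ?K)"
      using cont by (auto intro!: compact_imp_bounded compact_continuous_image)
    then obtain B1 B2 where B: "\<And>a. a \<in> ?K \<Longrightarrow> norm (\<beta>\<^sub>1 a) \<le> B1" "\<And>a. a \<in> ?K \<Longrightarrow> norm (\<beta>\<^sub>2 a) \<le> B2"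
      unfolding bounded_iff by (metis imageI)
    define M1 where "M1 m = pochhammer B1 m / fact m * (\<rho> * norm x) ^ m" for m
    define M2 where "M2 n = pochhammer B2 n / fact n * (\<rho> * norm y) ^ n" for n
    define M where "M = (\<lambda>(m, n). \<bar>C\<bar> * norm (M1 m * M2 n))"
    have M_summable: "M summable_on UNIV"
    proof -
      have "(\<lambda>p. norm (case p of (m, n) \<Rightarrow> M1 m * M2 n)) summable_on UNIV \<times> UNIV"
        unfolding M1_def M2_def using \<rho> \<rho>_less
        by (intro summable_norm_Times_mult pochhammer_series_summable_norm) (auto simp: abs_mult)
      from summable_on_cmult_right[OF this, of "\<bar>C\<bar>"] show ?thesis
        by (simp add: M_def case_prod_unfold)
    qed
    have f_le: "norm (f p a) \<le> M p" if a: "a \<in> ?K" for p a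
    proof -
      obtain m n where p: "p = (m, n)" by fastforce
      have le: "norm (pochhammer b m / fact m * w ^ m) \<le> pochhammer B m / fact m * norm w ^ m"
        if "norm b \<le> B" for b w :: complex and B :: real and m
        using that by (auto simp: norm_mult norm_divide norm_power intro!: mult_right_mono divide_right_mono norm_pochhammer_le)
      have "norm (f p a) = norm (pochhammer (\<alpha> a) (m + n) * rGamma (\<gamma> a + of_nat (m + n))) *
          (norm (pochhammer (\<beta>\<^sub>1 a) m / fact m * x ^ m) * norm (pochhammer (\<beta>\<^sub>2 a) n / fact n * y ^ n))"
        by (simp only: f_def p norm_mult case_prod_conv)
      also have "\<dots> \<le> (\<bar>C\<bar> * \<rho> ^ (m + n)) *
          ((pochhammer B1 m / fact m * norm x ^ m) * (pochhammer B2 n / fact n * norm y ^ n))"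
      proof (intro mult_mono le B a)
        have "C * \<rho> ^ (m + n) \<le> \<bar>C\<bar> * \<rho> ^ (m + n)"
          using \<rho> by (intro mult_right_mono) auto
        with C[OF a, of "m + n"]
        show "norm (pochhammer (\<alpha> a) (m + n) * rGamma (\<gamma> a + of_nat (m + n))) \<le> \<bar>C\<bar> * \<rho> ^ (m + n)"
          by linarith
        show "0 \<le> pochhammer B1 m / fact m * norm x ^ m"
          using le[OF B(1)[OF a], of m x] norm_ge_zero order_trans by blast
        show "0 \<le> \<bar>C\<bar> * \<rho> ^ (m + n)" using \<rho> by simp
      qed auto
      also have "\<dots> = \<bar>C\<bar> * (M1 m * M2 n)"
        by (simp add: M1_def M2_def power_mult_distrib power_add mult_ac)
      also have "\<dots> \<le> M p"
        by (simp add: M_def p mult_left_mono)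
      finally show ?thesis .
    qed
    have "\<forall>\<^sub>F X in finite_subsets_at_top UNIV.
        continuous_on ?K (\<lambda>a. \<Sum>p\<in>X. f p a) \<and> (\<lambda>a. \<Sum>p\<in>X. f p a) holomorphic_on ball z r"
    proof (intro always_eventually allI)
      fix X
      have "(\<lambda>a. \<Sum>p\<in>X. f p a) holomorphic_on S"
        using f_hol by (intro holomorphic_intros)
      then show "continuous_on ?K (\<lambda>a. \<Sum>p\<in>X. f p a) \<and> (\<lambda>a. \<Sum>p\<in>X. f p a) holomorphic_on ball z r"
        using r ball_subset_cball by (meson holomorphic_on_imp_continuous_on holomorphic_on_subset)
    qed
    moreover have "uniform_limit ?K (\<lambda>X a. \<Sum>p\<in>X. f p a) (\<lambda>a. \<Sum>\<^sub>\<infinity>p. f p a) (finite_subsets_at_top UNIV)"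
      using f_le M_summable by (intro Weierstrass_m_test_general) auto
    ultimately show ?thesis
      by (rule holomorphic_uniform_limit) auto
  qed
  then have "(\<lambda>a. \<Sum>\<^sub>\<infinity>p. f p a) analytic_on S"
    unfolding analytic_on_def using open_contains_cball[THEN iffD1, OF \<open>open S\<close>] by blast
  then have "(\<lambda>a. \<Sum>\<^sub>\<infinity>p. f p a) holomorphic_on S"
    by (rule analytic_imp_holomorphic)
  then show ?thesis
    by (simp add: appell_F1_reg_def f_def case_prod_unfold)
qed

section \<open>Evaluation of the Euler integral by an algebraic substitution\<close>

text \<open>The substitution \<open>w = (1 - s) / 2\<close> turns the integral into a multiple of
  that for \<open>Beta a a\<close>. The exponents stay unsimplified to match Euler's integral with
  \<open>\<alpha> = 2 * a\<close> and \<open>\<gamma> = 3 * a\<close>.\<close>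

lemma has_integral_appell_special:
  fixes a :: real
  assumes "a > 1"
  shows "((\<lambda>u. u powr (2 * a - 1) * (1 - u) powr (3 * a - 2 * a - 1) *
           ((1 - (-(3/125)) * u) powr (-(1 - 3 * a)) * (1 - 9/25 * u) powr (-(5 * a - 3/2))))
         has_integral (20/27) powr a * 2 powr (2 * a - 1) * Beta a a) {0..1}"
proof -
  define N where "N u = 1 - 9/10 * u - 54/125 * u^2 + 27/6250 * u^3" for u :: real
  \<comment> \<open>Here \<open>s\<close> is \<open>N u * (1 - 9/25 * u) powr (-(5/2))\<close>, so
    \<open>4 * w * (1 - w) = 1 - s^2\<close>, which will be \<open>t\<close>. The function
    \<open>w'\<close> is the derivative of \<open>w\<close>; its factors divide those of
    \<open>t\<close>, so the integrand becomes a product of powers.\<close>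
  define w where "w u = (1 - N u * (1 - 9/25 * u) powr (-(5/2))) / 2" for u :: real
  define t where "t u = 27/20 * u^2 * (1 - u) * (1 + 3/125 * u)^3 * (1 - 9/25 * u) powr (-5)" for u :: real
  define w' where "w' u = 27/40 * u * (1 + 3/125 * u)^2 * (1 - 9/25 * u) powr (-(7/2))" for u :: real
  \<comment> \<open>\<open>N\<close> is the cubic Taylor polynomial at 0 of the square root of the difference of the other two terms;
    that the square root is exactly a polynomial is the coincidence behind the closed form.\<close>
  have poly: "(N u)^2 + 27/20 * u^2 * (1 - u) * (1 + 3/125 * u)^3 = (1 - 9/25 * u)^5" for u
    by (simp add: N_def eval_nat_numeral field_simps)
  have ww: "4 * w u * (1 - w u) = t u" if u: "u \<in> {0..1}" for u
  proof -
    have pos: "1 - 9/25 * u > 0" using u by simp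
    have "4 * w u * (1 - w u) = 1 - (N u)^2 * ((1 - 9/25 * u) powr (-(5/2)))^2"
      by (simp add: w_def field_simps power2_eq_square)
    also have "((1 - 9/25 * u) powr (-(5/2)))^2 = (1 - 9/25 * u) powr (-5)"
      by (simp add: power2_eq_square flip: powr_add)
    also have "1 - (N u)^2 * (1 - 9/25 * u) powr (-5) = ((1 - 9/25 * u)^5 - (N u)^2) * (1 - 9/25 * u) powr (-5)"
      using pos by (simp add: left_diff_distrib powr_minus)
    also have "\<dots> = t u"
      unfolding poly[of u, symmetric] t_def by simp
    finally show ?thesis .
  qed
  have w01: "w u \<in> {0..1}" if u: "u \<in> {0..1}" for u
  proof -
    \<comment> \<open>The sign of \<open>w * (1 - w)\<close> alone confines \<open>w\<close> to the
      unit interval, which is the range condition of the substitution below.\<close>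
    have "t u \<ge> 0" using u by (auto simp: t_def)
    then have "0 \<le> w u * (1 - w u)" using ww[OF u] by simp
    then show ?thesis by (auto simp: zero_le_mult_iff)
  qed
  have w_deriv: "(w has_real_derivative w' u) (at u within {0..1})" if u: "u \<in> {0..1}" for u
  proof -
    have pos: "1 - 9/25 * u > 0" using u by simp
    \<comment> \<open>Brings both terms of the derivative to the common exponent -7/2, leaving a
      polynomial identity.\<close>
    have e: "(1 - 9/25 * u) powr (-(5/2)) = (1 - 9/25 * u) * (1 - 9/25 * u) powr (-(7/2))"
      using pos powr_add[of "1 - 9/25 * u" 1 "-(7/2)"] by simp
    have factor: "(A * (p * Q) - B * (9/10 * Q)) / 2 = (A * p - 9/10 * B) / 2 * Q" for A B p Q :: real
      by (simp add: field_simps)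
    have "(w has_real_derivative
        (- (- 9/10 - 108/125 * u + 81/6250 * u^2) * (1 - 9/25 * u) powr (-(5/2))
         - N u * (9/10 * (1 - 9/25 * u) powr (-(7/2)))) / 2) (at u within {0..1})"
      unfolding w_def N_def using pos
      by (auto intro!: derivative_eq_intros simp: power2_eq_square field_simps)
    also have "(- (- 9/10 - 108/125 * u + 81/6250 * u^2) * (1 - 9/25 * u) powr (-(5/2))
         - N u * (9/10 * (1 - 9/25 * u) powr (-(7/2)))) / 2
       = (- (- 9/10 - 108/125 * u + 81/6250 * u^2) * (1 - 9/25 * u) - 9/10 * N u) / 2 * (1 - 9/25 * u) powr (-(7/2))"
      unfolding e by (rule factor)
    also have "(- (- 9/10 - 108/125 * u + 81/6250 * u^2) * (1 - 9/25 * u) - 9/10 * N u) / 2 =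
        27/40 * u * (1 + 3/125 * u)^2"
      by (simp add: N_def eval_nat_numeral field_simps)
    finally show ?thesis by (simp add: w'_def)
  qed
  have w0: "w 0 = 0"
    by (simp add: w_def N_def)
  \<comment> \<open>At \<open>u = 1\<close> the base is 16/25 and \<open>N 1 = -((4/5)^5)\<close>,
    so \<open>s = -1\<close> and \<open>w 1 = 1\<close>.\<close>
  have "(16/25 :: real) powr (5/2) = ((4/5) powr 2) powr (5/2)"
    by (simp add: power2_eq_square)
  also have "\<dots> = (4/5) ^ 5"
    by (simp only: powr_powr) simp
  finally have eq: "(16/25 :: real) powr (5/2) = (4/5) ^ 5" .
  have "(16/25 :: real) powr (-(5/2)) = (5/4) ^ 5"
    unfolding powr_minus eq by (simp add: power_divide)
  then have w1: "w 1 = 1"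
    by (simp add: w_def N_def power_divide)
  have "((\<lambda>u. w' u *\<^sub>R (w u powr (a - 1) * (1 - w u) powr (a - 1))) has_integral
          integral {w 0..w 1} (\<lambda>x. x powr (a - 1) * (1 - x) powr (a - 1))) {0..1}"
    using assms w01 w_deriv
    by (intro has_integral_substitution[where c = 0 and d = 1] continuous_intros continuous_on_powr')
       (auto simp: w0 w1)
  also have "integral {w 0..w 1} (\<lambda>x. x powr (a - 1) * (1 - x) powr (a - 1)) = Beta a a"
    using has_integral_Beta_real[of a a] assms by (simp add: w0 w1 integral_unique)
  finally have "((\<lambda>u. (20/27) powr a * 2 powr (2 * a - 1) * (w' u *\<^sub>R (w u powr (a - 1) * (1 - w u) powr (a - 1))))
      has_integral (20/27) powr a * 2 powr (2 * a - 1) * Beta a a) {0..1}"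
    by (rule has_integral_mult_right)
  then show ?thesis
  proof (rule has_integral_eq[rotated])
    fix u :: real assume u: "u \<in> {0..1}"
    define p where "p = 1 - 9/25 * u"
    define q where "q = 1 + 3/125 * u"
    have pos: "p > 0" "q > 0" using u by (auto simp: p_def q_def)
    have w_prod: "w u * (1 - w u) = t u / 4"
      using ww[OF u] by simp
    have powr_mult_5: "(c1 * c2 * c3 * c4 * c5) powr r = c1 powr r * c2 powr r * c3 powr r * c4 powr r * c5 powr r"
      if "c1 \<ge> 0" "c2 \<ge> 0" "c3 \<ge> 0" "c4 \<ge> 0" "c5 \<ge> 0" for c1 c2 c3 c4 c5 r :: real
      using that by (simp add: powr_mult)
    have "w u powr (a - 1) * (1 - w u) powr (a - 1) = (w u * (1 - w u)) powr (a - 1)"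
      using w01[OF u] by (simp add: powr_mult)
    also have "\<dots> = (27/80 * u^2 * (1 - u) * q^3 * p powr (-5)) powr (a - 1)"
      by (simp add: w_prod t_def p_def q_def)
    also have "\<dots> = (27/80) powr (a - 1) * (u^2) powr (a - 1) * (1 - u) powr (a - 1) * (q^3) powr (a - 1) * p powr (-5 * (a - 1))"
      using u pos by (subst powr_mult_5) (auto simp: powr_powr)
    also have "(q^3) powr (a - 1) = q powr (3 * (a - 1))"
      using pos by (simp add: powr_powr flip: powr_numeral)
    also have "(u^2) powr (a - 1) = u powr (2 * (a - 1))"
      using u by (simp add: powr_powr flip: powr_numeral)
    finally have A: "w u powr (a - 1) * (1 - w u) powr (a - 1) =
      (27/80) powr (a - 1) * u powr (2 * (a - 1)) * (1 - u) powr (a - 1) * q powr (3 * (a - 1)) * p powr (-5 * (a - 1))" .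
    have B: "w' u = 27/40 * u * q^2 * p powr (-(7/2))"
      by (simp add: w'_def p_def q_def)
    have C1: "u powr (2 * a - 1) = u * u powr (2 * (a - 1))"
    proof (cases "u = 0")
      case False
      then show ?thesis using u powr_add[of u 1 "2 * (a - 1)"] by (simp add: algebra_simps)
    qed simp
    have C2: "q powr (-(1 - 3 * a)) = q^2 * q powr (3 * (a - 1))"
      using pos powr_add[of q 2 "3 * (a - 1)"] by (simp add: algebra_simps)
    have C3: "p powr (-(5 * a - 3/2)) = p powr (-(7/2)) * p powr (-5 * (a - 1))"
      by (simp add: algebra_simps flip: powr_add)
    \<comment> \<open>The bases multiply to \<open>20/27 * 4 * (27/80) = 1\<close>, so the
      dependence on \<open>a\<close> cancels; the remaining 40/27 cancels the 27/40 of
      \<open>w'\<close>.\<close>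
    have "(20/27 :: real) powr a * 2 powr (2 * a - 1) * (27/80) powr (a - 1)
        = (20/27) powr a * ((2 powr 2) powr a / 2) * ((27/80) powr a / (27/80))"
      by (simp only: powr_powr powr_diff) simp
    also have "\<dots> = (20/27 * 4 * (27/80)) powr a / (2 * (27/80))"
      by (simp add: powr_mult [symmetric] del: powr_mult)
    finally have D: "(20/27 :: real) powr a * 2 powr (2 * a - 1) * (27/80) powr (a - 1) = 40/27"
      by simp
    have "(20/27) powr a * 2 powr (2 * a - 1) * (w' u *\<^sub>R (w u powr (a - 1) * (1 - w u) powr (a - 1))) =
      ((20/27) powr a * 2 powr (2 * a - 1) * (27/80) powr (a - 1)) * (27/40) *
        (u * u powr (2 * (a - 1))) * (1 - u) powr (a - 1) * (q^2 * q powr (3 * (a - 1))) * (p powr (-(7/2)) * p powr (-5 * (a - 1)))"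
      unfolding A B by (simp only: mult_ac real_scaleR_def)
    also have "\<dots> = u powr (2 * a - 1) * (1 - u) powr (a - 1) * (q powr (-(1 - 3 * a)) * p powr (-(5 * a - 3/2)))"
      unfolding D C1 C2 C3 by simp
    finally show "(20/27) powr a * 2 powr (2 * a - 1) * (w' u *\<^sub>R (w u powr (a - 1) * (1 - w u) powr (a - 1))) =
       u powr (2 * a - 1) * (1 - u) powr (3 * a - 2 * a - 1) *
           ((1 - (-(3/125)) * u) powr (-(1 - 3 * a)) * (1 - 9/25 * u) powr (-(5 * a - 3/2)))"
      by (simp add: p_def q_def)
  qed
qed

section \<open>The closed form for real parameters\<close>

text \<open>Legendre's duplication formula in Beta form. It absorbs the power of 2 and leaves a
  single \<open>Gamma a\<close>, which cancels against the one in
  \<open>Beta (2 * a) a\<close>.\<close>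

lemma Beta_same_real:
  fixes a :: real
  assumes "a > 0"
  shows "2 powr (2 * a - 1) * Beta a a = Beta a (1/2)"
proof -
  have "complex_of_real a \<notin> \<int>\<^sub>\<le>\<^sub>0" "complex_of_real a + 1 / 2 \<notin> \<int>\<^sub>\<le>\<^sub>0"
    using assms by (auto elim!: nonpos_Ints_cases simp: complex_eq_iff)
  from Gamma_legendre_duplication[OF this]
  have "of_real (Gamma a * Gamma (a + 1/2)) =
      complex_of_real (exp ((1 - 2 * a) * ln 2) * sqrt pi * Gamma (2 * a))"
    by (simp flip: Gamma_complex_of_real exp_of_real)
  then have "Gamma a * Gamma (a + 1/2) = exp ((1 - 2 * a) * ln 2) * sqrt pi * Gamma (2 * a)"
    by (simp only: of_real_eq_iff)
  also have "exp ((1 - 2 * a) * ln 2) = inverse (2 powr (2 * a - 1))"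
    by (simp add: powr_def flip: exp_minus) (simp add: algebra_simps)
  finally have dup: "2 powr (2 * a - 1) * (Gamma a * Gamma (a + 1/2)) = sqrt pi * Gamma (2 * a)"
    by simp
  have pos: "Gamma a > 0" "Gamma (a + 1/2) > 0" "Gamma (2 * a) > 0"
    using assms by (auto intro!: Gamma_real_pos)
  have "2 powr (2 * a - 1) * Beta a a = 2 powr (2 * a - 1) * (Gamma a * Gamma (a + 1/2)) * Gamma a / (Gamma (2 * a) * Gamma (a + 1/2))"
    using pos by (simp add: Beta_def)
  also have "\<dots> = Beta a (1/2)"
    using pos unfolding dup by (simp add: Beta_def Gamma_one_half_real)
  finally show ?thesis .
qed

text \<open>Euler's integral at \<open>\<alpha> = 2 * a\<close>, \<open>\<gamma> = 3 * a\<close>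
  requires both \<open>2 * a > 1\<close> and \<open>a > 1\<close>, whence the range of
  \<open>a\<close>.\<close>

lemma appell_F1_special_value_real:
  fixes a :: real
  assumes "a > 1"
  defines "z \<equiv> complex_of_real a"
  shows "appell_F1 (2 * z) (1 - 3 * z) (5 * z - 3 / 2) (3 * z) (- (3 / 125)) (9 / 25) =
           2 powr (2 * z) * 5 powr z / 3 powr (3 * z) *
           (of_real (sqrt pi) * Gamma (3 * z) * rGamma (z + 1 / 2) * rGamma (2 * z))"
proof -
  let ?I = "(20/27) powr a * 2 powr (2 * a - 1) * Beta a a"
  have "appell_F1 (2 * z) (1 - 3 * z) (5 * z - 3 / 2) (3 * z) (- (3 / 125)) (9 / 25) =
      of_real (?I / Beta (2 * a) (3 * a - 2 * a))"
    using appell_F1_Euler_integral[OF _ _ _ _ has_integral_appell_special[OF \<open>a > 1\<close>]] \<open>a > 1\<close>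
    by (simp add: z_def)
  also have "?I = (20/27) powr a * Beta a (1/2)"
    using Beta_same_real[of a] assms by (simp add: mult.assoc)
  also have "(20/27) powr a * Beta a (1/2) / Beta (2 * a) (3 * a - 2 * a) =
      (20/27) powr a * (sqrt pi * Gamma (3 * a) * rGamma (a + 1/2) * rGamma (2 * a))"
  proof -
    have "Gamma a > 0" "Gamma (a + 1/2) > 0" "Gamma (2 * a) > 0" "Gamma (3 * a) > 0"
      using assms by (auto intro!: Gamma_real_pos)
    then show ?thesis
      by (simp add: Beta_def Gamma_one_half_real rGamma_inverse_Gamma divide_simps)
  qed
  also have "(20/27 :: real) powr a = 2 powr (2 * a) * 5 powr a / 3 powr (3 * a)"
  proof -
    have "(2 :: real) powr (2 * a) = 4 powr a" "(3 :: real) powr (3 * a) = 27 powr a"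
      by (simp_all flip: powr_powr)
    then show ?thesis
      by (simp flip: powr_mult powr_divide)
  qed
  also have "complex_of_real (2 powr (2 * a) * 5 powr a / 3 powr (3 * a) *
        (sqrt pi * Gamma (3 * a) * rGamma (a + 1/2) * rGamma (2 * a))) =
      2 powr (2 * z) * 5 powr z / 3 powr (3 * z) *
           (of_real (sqrt pi) * Gamma (3 * z) * rGamma (z + 1 / 2) * rGamma (2 * z))"
    by (simp add: z_def flip: Gamma_complex_of_real rGamma_complex_of_real powr_of_real)
  finally show ?thesis .
qed

section \<open>Analytic continuation to complex parameters\<close>

theorem mainTheorem12:
  fixes a :: complex
  assumes "3 * a \<notin> \<int>\<^sub>\<le>\<^sub>0"
  shows "appell_F1 (2 * a) (1 - 3 * a) (5 * a - 3 / 2) (3 * a) (- (3 / 125)) (9 / 25) =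
           2 powr (2 * a) * 5 powr a / 3 powr (3 * a) *
           (of_real (sqrt pi) * Gamma (3 * a) * rGamma (a + 1 / 2) * rGamma (2 * a))"
proof -
  \<comment> \<open>\<open>L\<close> and \<open>R\<close> are the two sides divided by
    \<open>Gamma (3 * z)\<close>; both are entire, so the identity theorem can be used on the whole
    connected plane.\<close>
  define L where "L z = appell_F1_reg (2 * z) (1 - 3 * z) (5 * z - 3 / 2) (3 * z) (- (3 / 125)) (9 / 25)" for z
  define R where "R z = 2 powr (2 * z) * 5 powr z / 3 powr (3 * z) *
      (of_real (sqrt pi) * rGamma (z + 1 / 2) * rGamma (2 * z))" for z :: complex
  have hol: "(\<lambda>z. L z - R z) holomorphic_on UNIV"
    unfolding L_def R_def
    by (intro holomorphic_intros holomorphic_on_appell_F1_reg) (auto simp: norm_divide)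
  \<comment> \<open>The point 2 is an arbitrary choice of accumulation point of the ray where the
    identity is known.\<close>
  have lim: "2 islimpt complex_of_real ` {1<..}"
  proof -
    have "(2 :: real) islimpt {1<..}"
      by (intro interior_limit_point) (simp add: interior_open)
    then have "complex_of_real 2 islimpt complex_of_real ` {1<..}"
      by (intro islimpt_isCont_image) (auto intro!: continuous_intros simp: eventually_at_filter simp del: of_real_numeral)
    then show ?thesis by simp
  qed
  have zero: "L z - R z = 0" if z: "z \<in> complex_of_real ` {1<..}" for z
  proof -
    obtain t where t: "z = complex_of_real t" "t > 1" using z by auto
    then have "3 * z \<notin> \<int>\<^sub>\<le>\<^sub>0"
      by (auto elim!: nonpos_Ints_cases simp: complex_eq_iff)
    then have "rGamma (3 * z) * Gamma (3 * z) = 1"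
      by (simp add: rGamma_inverse_Gamma Gamma_eq_zero_iff)
    with appell_F1_reg_eq[OF \<open>3 * z \<notin> \<int>\<^sub>\<le>\<^sub>0\<close>] appell_F1_special_value_real[OF \<open>t > 1\<close>] t
    show ?thesis
      by (simp add: L_def R_def mult_ac)
  qed
  have "L a - R a = 0"
    using analytic_continuation[OF hol open_UNIV connected_UNIV subset_UNIV UNIV_I lim zero UNIV_I] .
  then have "rGamma (3 * a) * appell_F1 (2 * a) (1 - 3 * a) (5 * a - 3 / 2) (3 * a) (- (3 / 125)) (9 / 25) = R a"
    using appell_F1_reg_eq[OF assms] by (simp add: L_def)
  moreover have "Gamma (3 * a) * rGamma (3 * a) = 1"
    using assms by (simp add: rGamma_inverse_Gamma Gamma_eq_zero_iff)
  ultimately have "appell_F1 (2 * a) (1 - 3 * a) (5 * a - 3 / 2) (3 * a) (- (3 / 125)) (9 / 25) = Gamma (3 * a) * R a"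
    by (metis mult.assoc mult_1)
  then show ?thesis
    by (simp add: R_def mult_ac)
qed

end
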